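(* Let $S$ be a commutative semiring with $1\neq 0$, let $M$ be an $MC$ multiplication $S$-semimodule, and let $N$ be a proper subsemimodule of $M$. Then: (1) $N$ is a $1$-absorbing prime subsemimodule of $M$ if and only if $(N:_S M)$ is a $1$-absorbing prime ideal of $S$. (2) $N$ is a $1$-absorbing prime subsemimodule of $M$ if and only if $N=IM$ for some $1$-absorbing prime ideal $I$ of $S$.
   Context: Semimodules are unital. For a subsemimodule $N$ of $M$, $(N:_S M)=\{s\in S\mid sM\subseteq N\}$, an ideal of $S$. A proper subsemimodule $N$ of $M$ is $1$-absorbing prime if for all nonunits $a,b\in S$ and all $m\in M$, $abm\in N$ implies $ab\in (N:_S M)$ or $m\in N$. A proper ideal $I$ of $S$ is $1$-absorbing prime if for all nonunits $a,b,c\in S$, $abc\in I$ implies $ab\in I$ or $c\in I$. $M$ is a multiplication $S$-semimodule if for each subsemimodule $N$ of $M$ there is an ideal $I$ of $S$ with $N=IM$. $M$ is multiplicatively cancellative ($MC$) if for all $s,s'\in S$ and $0\neq x\in M$, $sx=s'x$ implies $s=s'$. *)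

theory Defs
  imports Main
begin

text \<open>
  The semiring $S$ is a type of class \<open>comm_semiring_1\<close>, which includes $0 \neq 1$ and $0 \cdot a = 0$;
  the units of $S$ are the divisors of 1. The library's \<open>module\<close> locale requires a ring acting
  on a group, hence the following semiring version.
\<close>

locale semimodule =
  fixes scale :: "'a::comm_semiring_1 \<Rightarrow> 'b::comm_monoid_add \<Rightarrow> 'b"
  assumes scale_right_distrib: "scale a (x + y) = scale a x + scale a y"
    and scale_left_distrib: "scale (a + b) x = scale a x + scale b x"
    and scale_scale: "scale a (scale b x) = scale (a * b) x"
    and scale_one: "scale 1 x = x"
    and scale_zero_left: "scale 0 x = 0"
    and scale_zero_right: "scale a 0 = 0"

definition subsemimodule :: "('a::comm_semiring_1 \<Rightarrow> 'b::comm_monoid_add \<Rightarrow> 'b) \<Rightarrow> 'b set \<Rightarrow> bool"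
  where "subsemimodule scale N \<longleftrightarrow>
    0 \<in> N \<and> (\<forall>x\<in>N. \<forall>y\<in>N. x + y \<in> N) \<and> (\<forall>a. \<forall>x\<in>N. scale a x \<in> N)"

definition semiring_ideal :: "'a::comm_semiring_1 set \<Rightarrow> bool"
  where "semiring_ideal I \<longleftrightarrow>
    0 \<in> I \<and> (\<forall>a\<in>I. \<forall>b\<in>I. a + b \<in> I) \<and> (\<forall>s. \<forall>a\<in>I. s * a \<in> I)"

text \<open>$(N :_S M)$, where $M$ is the whole type \<open>'b\<close>.\<close>

definition colon :: "('a::comm_semiring_1 \<Rightarrow> 'b::comm_monoid_add \<Rightarrow> 'b) \<Rightarrow> 'b set \<Rightarrow> 'a set"
  where "colon scale N = {s. \<forall>m. scale s m \<in> N}"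

text \<open>$IM$: all finite sums of elements $am$ with $a \in I$ and $m \in M$.\<close>

definition ideal_mult :: "('a::comm_semiring_1 \<Rightarrow> 'b::comm_monoid_add \<Rightarrow> 'b) \<Rightarrow> 'a set \<Rightarrow> 'b set"
  where "ideal_mult scale I =
    {\<Sum>i<n. scale (a i) (m i) | (n::nat) a m. \<forall>i<n. a i \<in> I}"

definition one_absorbing_prime_subsemimodule ::
    "('a::comm_semiring_1 \<Rightarrow> 'b::comm_monoid_add \<Rightarrow> 'b) \<Rightarrow> 'b set \<Rightarrow> bool"
  where "one_absorbing_prime_subsemimodule scale N \<longleftrightarrow>
    subsemimodule scale N \<and> N \<noteq> UNIV \<and>
    (\<forall>a b m. \<not> a dvd 1 \<longrightarrow> \<not> b dvd 1 \<longrightarrow> scale (a * b) m \<in> N \<longrightarrow>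
      a * b \<in> colon scale N \<or> m \<in> N)"

definition one_absorbing_prime_ideal :: "'a::comm_semiring_1 set \<Rightarrow> bool"
  where "one_absorbing_prime_ideal I \<longleftrightarrow>
    semiring_ideal I \<and> I \<noteq> UNIV \<and>
    (\<forall>a b c. \<not> a dvd 1 \<longrightarrow> \<not> b dvd 1 \<longrightarrow> \<not> c dvd 1 \<longrightarrow> a * b * c \<in> I \<longrightarrow>
      a * b \<in> I \<or> c \<in> I)"

definition multiplication_semimodule ::
    "('a::comm_semiring_1 \<Rightarrow> 'b::comm_monoid_add \<Rightarrow> 'b) \<Rightarrow> bool"
  where "multiplication_semimodule scale \<longleftrightarrow> semimodule scale \<and>
    (\<forall>N. subsemimodule scale N \<longrightarrow> (\<exists>I. semiring_ideal I \<and> N = ideal_mult scale I))"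

definition multiplicatively_cancellative ::
    "('a::comm_semiring_1 \<Rightarrow> 'b::comm_monoid_add \<Rightarrow> 'b) \<Rightarrow> bool"
  where "multiplicatively_cancellative scale \<longleftrightarrow> semimodule scale \<and>
    (\<forall>s s' x. x \<noteq> 0 \<longrightarrow> scale s x = scale s' x \<longrightarrow> s = s')"

end

theory Submission
  imports Defs
begin

text \<open>
  In a multiplication semimodule a cyclic subsemimodule \<open>Sm\<close> is \<open>IM\<close> for some ideal \<open>I\<close>, so the
  condition \<open>abm \<in> N\<close> on a single vector becomes the condition \<open>abI \<subseteq> (N : M)\<close> on scalars. If \<open>I\<close>
  consists of nonunits, 1-absorption of \<open>(N : M)\<close> yields \<open>ab \<in> (N : M)\<close> or \<open>I \<subseteq> (N : M)\<close>, and the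
  latter means \<open>m \<in> IM \<subseteq> N\<close>; if \<open>I\<close> contains a unit, \<open>ab \<in> (N : M)\<close> follows at once. Conversely,
  \<open>abc \<in> (N : M)\<close> says that \<open>ab(cm) \<in> N\<close> for every \<open>m\<close>, so 1-absorption of \<open>N\<close> applies to each \<open>cm\<close>.

  For the second equivalence, \<open>N = (N : M)M\<close> gives one direction. The other follows from the first
  equivalence once \<open>(IM : M) = I\<close> is known for every ideal \<open>I\<close>. This is where cancellation enters.
  Fix \<open>x \<noteq> 0\<close> and write \<open>Sx = JM\<close>. Multiplication by any \<open>j \<in> J\<close> maps \<open>M\<close> into \<open>Sx\<close>, hence \<open>IM\<close>
  into \<open>Ix\<close>. If \<open>sM \<subseteq> IM\<close>, then \<open>s(jm) = j(sm) \<in> Ix\<close> for all \<open>j \<in> J\<close> and all \<open>m\<close>, so \<open>s\<close> maps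
  \<open>JM\<close> into \<open>Ix\<close>. As \<open>x \<in> JM\<close>, there is \<open>a \<in> I\<close> with \<open>sx = ax\<close>, and cancelling \<open>x\<close> gives
  \<open>s = a \<in> I\<close>.
\<close>

lemma scale_in_ideal_mult:
  assumes "a \<in> I"
  shows "scale a m \<in> ideal_mult scale I"
proof -
  have "scale a m = (\<Sum>i<1::nat. scale ((\<lambda>_. a) i) ((\<lambda>_. m) i)) \<and>
      (\<forall>i<1. (\<lambda>_. a) i \<in> I)"
    using assms by simp
  then show ?thesis
    unfolding ideal_mult_def mem_Collect_eq by (intro exI)
qed

text \<open>
  \<open>IM\<close> is the least subsemimodule containing all \<open>am\<close>; this replaces explicit finite sums
  everywhere else.
\<close>

lemma ideal_mult_subset:
  assumes P: "subsemimodule scale P" and gen: "\<And>a m. a \<in> I \<Longrightarrow> scale a m \<in> P"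
  shows "ideal_mult scale I \<subseteq> P"
proof
  fix z assume "z \<in> ideal_mult scale I"
  then obtain n :: nat and a m
    where z: "z = (\<Sum>i<n. scale (a i) (m i))" and a: "\<forall>i<n. a i \<in> I"
    unfolding ideal_mult_def by blast
  from a have "(\<Sum>i<n. scale (a i) (m i)) \<in> P"
    by (induction n) (use P gen in \<open>auto simp: subsemimodule_def\<close>)
  then show "z \<in> P" using z by simp
qed

context semimodule
begin

lemma scale_left_commute: "scale a (scale b x) = scale b (scale a x)"
  by (simp add: scale_scale mult.commute)

lemma subsemimodule_cyclic: "subsemimodule scale (range (\<lambda>s. scale s x))"
  unfolding subsemimodule_def
proof (intro conjI ballI allI)
  show "0 \<in> range (\<lambda>s. scale s x)"
    using scale_zero_left[of x] by (metis rangeI)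
next
  fix y z assume "y \<in> range (\<lambda>s. scale s x)" "z \<in> range (\<lambda>s. scale s x)"
  then show "y + z \<in> range (\<lambda>s. scale s x)"
    by (auto simp flip: scale_left_distrib)
next
  fix a y assume "y \<in> range (\<lambda>s. scale s x)"
  then show "scale a y \<in> range (\<lambda>s. scale s x)"
    by (auto simp: scale_scale)
qed

lemma semiring_ideal_colon:
  assumes "subsemimodule scale N"
  shows "semiring_ideal (colon scale N)"
  using assms
  by (auto simp: semiring_ideal_def colon_def subsemimodule_def scale_zero_left
      scale_left_distrib simp flip: scale_scale)

lemma colon_eq_UNIV_iff:
  assumes "subsemimodule scale N"
  shows "colon scale N = UNIV \<longleftrightarrow> N = UNIV"
  using assms by (auto simp: colon_def) (metis UNIV_I mem_Collect_eq scale_one)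

lemma ideal_mult_colon_subset:
  assumes "subsemimodule scale N"
  shows "ideal_mult scale (colon scale N) \<subseteq> N"
  using assms by (rule ideal_mult_subset) (simp add: colon_def)

text \<open>
  Multiplication by \<open>s\<close> is additive and commutes with scalars, so the preimage of the
  subsemimodule \<open>Ix\<close> under it is again a subsemimodule.
\<close>

lemma subsemimodule_preimage_ideal_cyclic:
  assumes I: "semiring_ideal I"
  shows "subsemimodule scale {z. scale s z \<in> (\<lambda>a. scale a x) ` I}"
  unfolding subsemimodule_def mem_Collect_eq
proof (intro conjI ballI allI; (unfold mem_Collect_eq)?)
  have "scale s 0 = scale 0 x" by (simp add: scale_zero_left scale_zero_right)
  then show "scale s 0 \<in> (\<lambda>a. scale a x) ` I"
    using I unfolding semiring_ideal_def by blast
next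
  fix y z
  assume "scale s y \<in> (\<lambda>a. scale a x) ` I" "scale s z \<in> (\<lambda>a. scale a x) ` I"
  then obtain a b where "a \<in> I" "scale s y = scale a x" "b \<in> I" "scale s z = scale b x"
    by blast
  then have "scale s (y + z) = scale (a + b) x" "a + b \<in> I"
    using I by (simp_all add: scale_right_distrib scale_left_distrib semiring_ideal_def)
  then show "scale s (y + z) \<in> (\<lambda>a. scale a x) ` I" by blast
next
  fix r z
  assume "scale s z \<in> (\<lambda>a. scale a x) ` I"
  then obtain a where "a \<in> I" "scale s z = scale a x" by blast
  then have "scale s (scale r z) = scale (r * a) x" "r * a \<in> I"
    using I by (simp_all add: scale_left_commute[of s r] semiring_ideal_def flip: scale_scale)
  then show "scale s (scale r z) \<in> (\<lambda>a. scale a x) ` I" by blast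
qed

lemma one_absorbing_prime_ideal_colon:
  assumes N: "one_absorbing_prime_subsemimodule scale N"
  shows "one_absorbing_prime_ideal (colon scale N)"
  unfolding one_absorbing_prime_ideal_def
proof (intro conjI allI impI)
  have sub: "subsemimodule scale N" and proper: "N \<noteq> UNIV"
    using N by (auto simp: one_absorbing_prime_subsemimodule_def)
  show "semiring_ideal (colon scale N)" by (rule semiring_ideal_colon[OF sub])
  show "colon scale N \<noteq> UNIV" using proper colon_eq_UNIV_iff[OF sub] by simp
  fix a b c
  assume ab: "\<not> a dvd 1" "\<not> b dvd 1" and abc: "a * b * c \<in> colon scale N"
  have "scale (a * b) (scale c m) \<in> N" for m
    using abc by (simp add: colon_def scale_scale)
  then have "a * b \<in> colon scale N \<or> scale c m \<in> N" for m
    using N ab unfolding one_absorbing_prime_subsemimodule_def by blast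
  then show "a * b \<in> colon scale N \<or> c \<in> colon scale N"
    by (auto simp: colon_def)
qed

text \<open>An ideal \<open>I\<close> with \<open>N = IM\<close> satisfies \<open>I \<subseteq> (N : M)\<close>, so \<open>(N : M)\<close> is the largest such ideal.\<close>

lemma ideal_mult_colon:
  assumes mult: "multiplication_semimodule scale" and N: "subsemimodule scale N"
  shows "ideal_mult scale (colon scale N) = N"
proof
  show "ideal_mult scale (colon scale N) \<subseteq> N" by (rule ideal_mult_colon_subset[OF N])
  obtain I where I: "N = ideal_mult scale I"
    using mult N unfolding multiplication_semimodule_def by blast
  then have "I \<subseteq> colon scale N"
    using scale_in_ideal_mult[of _ I scale] by (auto simp: colon_def)
  then show "N \<subseteq> ideal_mult scale (colon scale N)"
    unfolding I ideal_mult_def by blast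
qed

lemma cyclic_eq_ideal_mult:
  assumes "multiplication_semimodule scale"
  obtains I where "range (\<lambda>s. scale s x) = ideal_mult scale I"
  using assms subsemimodule_cyclic[of x] unfolding multiplication_semimodule_def by blast

text \<open>
  Writing \<open>Sm = IM\<close> turns \<open>abm \<in> N\<close> into \<open>abI \<subseteq> (N : M)\<close>. The case of a unit in \<open>I\<close> has to be
  treated apart, since 1-absorption speaks of nonunits only.
\<close>

lemma one_absorbing_prime_subsemimodule_if_colon:
  assumes mult: "multiplication_semimodule scale" and N: "subsemimodule scale N"
    and colon: "one_absorbing_prime_ideal (colon scale N)"
  shows "one_absorbing_prime_subsemimodule scale N"
  unfolding one_absorbing_prime_subsemimodule_def
proof (intro conjI allI impI)
  show "subsemimodule scale N" by (rule N)
  show "N \<noteq> UNIV"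
    using colon colon_eq_UNIV_iff[OF N] by (auto simp: one_absorbing_prime_ideal_def)
  fix a b m
  assume a: "\<not> a dvd 1" and b: "\<not> b dvd 1" and abm: "scale (a * b) m \<in> N"
  obtain I where I: "range (\<lambda>s. scale s m) = ideal_mult scale I"
    using cyclic_eq_ideal_mult[OF mult] .
  have abI: "a * b * i \<in> colon scale N" if "i \<in> I" for i
  proof -
    have "scale (a * b * i) y \<in> N" for y
    proof -
      have "scale i y \<in> range (\<lambda>s. scale s m)"
        unfolding I using that by (rule scale_in_ideal_mult)
      then obtain s where "scale i y = scale s m" by blast
      then have "scale (a * b * i) y = scale s (scale (a * b) m)"
        by (simp add: scale_left_commute[of s] flip: scale_scale)
      then show ?thesis using abm N by (simp add: subsemimodule_def)
    qed
    then show ?thesis by (simp add: colon_def)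
  qed
  show "a * b \<in> colon scale N \<or> m \<in> N"
  proof (cases "\<exists>i\<in>I. i dvd 1")
    case True
    then obtain i u where "i \<in> I" and u: "1 = i * u" by (auto elim: dvdE)
    then have "u * (a * b * i) \<in> colon scale N"
      using abI semiring_ideal_colon[OF N] by (simp add: semiring_ideal_def)
    moreover have "u * (a * b * i) = a * b * (i * u)" by (simp add: ac_simps)
    ultimately show ?thesis by (simp flip: u)
  next
    case False
    then have "a * b \<in> colon scale N \<or> i \<in> colon scale N" if "i \<in> I" for i
      using colon a b abI that unfolding one_absorbing_prime_ideal_def by blast
    then consider "a * b \<in> colon scale N" | "I \<subseteq> colon scale N" by blast
    then show ?thesis
    proof cases
      case 2
      have "m \<in> ideal_mult scale I" unfolding I[symmetric] using scale_one by (metis rangeI)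
      also have "ideal_mult scale I \<subseteq> N"
        using N by (rule ideal_mult_subset) (use 2 in \<open>auto simp: colon_def\<close>)
      finally show ?thesis ..
    qed simp
  qed
qed

text \<open>
  Cancellation law for ideals: applied to \<open>IM\<close>, the colon operation recovers \<open>I\<close>. Multiplication
  by an element \<open>j\<close> with \<open>jM \<subseteq> Sx\<close> sends \<open>IM\<close> into \<open>Ix\<close>, and \<open>x\<close> is itself a sum of vectors \<open>jm\<close>
  with such \<open>j\<close>; so \<open>sM \<subseteq> IM\<close> leads to an equation \<open>sx = ax\<close> with \<open>a \<in> I\<close>.
\<close>

lemma colon_ideal_mult:
  fixes x :: 'b
  assumes mult: "multiplication_semimodule scale"
    and mc: "multiplicatively_cancellative scale"
    and I: "semiring_ideal I" and x: "x \<noteq> 0"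
  shows "colon scale (ideal_mult scale I) = I"
proof
  show "I \<subseteq> colon scale (ideal_mult scale I)"
    by (auto simp: colon_def intro: scale_in_ideal_mult)
  let ?Ix = "(\<lambda>a. scale a x) ` I"
  obtain J where J: "range (\<lambda>s. scale s x) = ideal_mult scale J"
    using cyclic_eq_ideal_mult[OF mult] .
  have J_maps_IM: "ideal_mult scale I \<subseteq> {z. scale j z \<in> ?Ix}" if "j \<in> J" for j
  proof (rule ideal_mult_subset[OF subsemimodule_preimage_ideal_cyclic[OF I]])
    fix a y assume a: "a \<in> I"
    have "scale j y \<in> range (\<lambda>s. scale s x)"
      unfolding J using that by (rule scale_in_ideal_mult)
    then obtain t where "scale j y = scale t x" by blast
    then have "scale j (scale a y) = scale (t * a) x"
      by (simp add: scale_left_commute[of _ a] flip: scale_scale)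
    moreover have "t * a \<in> I" using I a by (simp add: semiring_ideal_def)
    ultimately show "scale a y \<in> {z. scale j z \<in> ?Ix}" by blast
  qed
  show "colon scale (ideal_mult scale I) \<subseteq> I"
  proof
    fix s assume s: "s \<in> colon scale (ideal_mult scale I)"
    have "ideal_mult scale J \<subseteq> {z. scale s z \<in> ?Ix}"
    proof (rule ideal_mult_subset[OF subsemimodule_preimage_ideal_cyclic[OF I]])
      fix j m assume j: "j \<in> J"
      have "scale s m \<in> ideal_mult scale I" using s by (simp add: colon_def)
      then have "scale j (scale s m) \<in> ?Ix" using J_maps_IM[OF j] by blast
      then show "scale j m \<in> {z. scale s z \<in> ?Ix}"
        by (simp add: scale_left_commute[of s])
    qed
    moreover have "x \<in> ideal_mult scale J"
      unfolding J[symmetric] using scale_one by (metis rangeI)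
    ultimately obtain a where "a \<in> I" "scale s x = scale a x" by blast
    then show "s \<in> I"
      using mc x unfolding multiplicatively_cancellative_def by blast
  qed
qed

end

theorem corollary2p15:
  fixes scale :: "'s::comm_semiring_1 \<Rightarrow> 'm::comm_monoid_add \<Rightarrow> 'm"
    and N :: "'m set"
  assumes "semimodule scale"
    and "multiplicatively_cancellative scale"
    and "multiplication_semimodule scale"
    and "subsemimodule scale N"
    and "N \<noteq> UNIV"
  shows "(one_absorbing_prime_subsemimodule scale N \<longleftrightarrow>
            one_absorbing_prime_ideal (colon scale N)) \<and>
         (one_absorbing_prime_subsemimodule scale N \<longleftrightarrow>
            (\<exists>I. one_absorbing_prime_ideal I \<and> N = ideal_mult scale I))"
proof -
  interpret semimodule scale by fact
  have colon_iff: "one_absorbing_prime_subsemimodule scale N \<longleftrightarrow>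
      one_absorbing_prime_ideal (colon scale N)"
    using one_absorbing_prime_ideal_colon
      one_absorbing_prime_subsemimodule_if_colon[OF assms(3,4)] by blast
  \<comment> \<open>A proper subsemimodule contains 0, so any vector outside it is nonzero.\<close>
  obtain x where "x \<notin> N" using assms(5) by blast
  then have "x \<noteq> 0" using assms(4) by (auto simp: subsemimodule_def)
  then have "colon scale N = I" if "one_absorbing_prime_ideal I" "N = ideal_mult scale I" for I
    using that colon_ideal_mult[OF assms(3,2)] by (simp add: one_absorbing_prime_ideal_def)
  then show ?thesis
    using colon_iff ideal_mult_colon[OF assms(3,4)] by metis
qed

end
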